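(* Let $\Omega\subset\mathbb{R}^n$ be an open set, let $0<\alpha<n$, and let $p:\Omega\to[1,\infty)$ be a measurable function such that $$1<\inf_{x\in\Omega}p(x)\le p(x)\le \sup_{x\in\Omega}p(x)<\frac{n}{\alpha}.$$ Let $q$ be defined on $\Omega$ by $\frac{1}{q(x)}=\frac{1}{p(x)}-\frac{\alpha}{n}$. Then for every measurable function $f$ on $\Omega$ and every $x\in\Omega$, $$M_{\alpha}f(x)\le \left(M\left(|f|^{\frac{p(\cdot)}{q(\cdot)}\frac{n}{n-\alpha}}\right)(x)\right)^{1-\alpha/n}\left(\int_{\Omega}|f(y)|^{p(y)}\,dy\right)^{\alpha/n}.$$
   Context: For $0\le\alpha<n$ and a measurable function $f$ on the open set $\Omega\subset\mathbb{R}^n$, the fractional maximal operator is $$M_{\alpha}f(x)=\sup_{B\ni x}\frac{1}{|B|^{1-\alpha/n}}\int_{B\cap\Omega}|f(y)|\,dy,$$ where the supremum is taken over all balls $B\subset\mathbb{R}^n$ containing $x$ and $|B|$ is Lebesgue measure. When $\alpha=0$, $M=M_0$ is the Hardy–Littlewood maximal operator. Both sides of the inequality take values in $[0,\infty]$. The function $|f|^{\frac{p(\cdot)}{q(\cdot)}\frac{n}{n-\alpha}}$ is $y\mapsto |f(y)|^{\frac{p(y)}{q(y)}\frac{n}{n-\alpha}}$. *)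

theory Defs
  imports "HOL-Analysis.Analysis"
begin

text \<open>Powers of extended nonnegative reals, intended for exponents \<open>a > 0\<close> only,
  where \<open>0\<close> to the power \<open>a\<close> is \<open>0\<close> and \<open>\<infinity>\<close> to the power \<open>a\<close> is \<open>\<infinity>\<close>.\<close>

definition ennreal_powr :: "ennreal \<Rightarrow> real \<Rightarrow> ennreal" where
  "ennreal_powr x a = (if x = \<infinity> then \<infinity> else ennreal (enn2real x powr a))"

text \<open>Functions on \<open>\<Omega>\<close> are total functions whose values outside \<open>\<Omega>\<close> are never used:
  the integral below is over \<open>B \<inter> \<Omega>\<close>.  The supremum is over open balls of positive radius
  containing \<open>x\<close>, not necessarily centred at \<open>x\<close>.\<close>

definition fractional_maximal ::
    "real \<Rightarrow> (real ^ 'n) set \<Rightarrow> (real ^ 'n \<Rightarrow> real) \<Rightarrow> real ^ 'n \<Rightarrow> ennreal" where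
  "fractional_maximal \<alpha> \<Omega> f x =
     (SUP B \<in> {ball c r | c r. 0 < r \<and> x \<in> ball c r}.
        (\<integral>\<^sup>+ y \<in> B \<inter> \<Omega>. ennreal \<bar>f y\<bar> \<partial>lebesgue)
          / ennreal_powr (emeasure lebesgue B) (1 - \<alpha> / real CARD('n)))"

abbreviation hardy_littlewood_maximal ::
    "(real ^ 'n) set \<Rightarrow> (real ^ 'n \<Rightarrow> real) \<Rightarrow> real ^ 'n \<Rightarrow> ennreal" where
  "hardy_littlewood_maximal \<equiv> fractional_maximal 0"

end

theory Submission
  imports Defs
begin

text \<open>Put \<open>\<theta> = 1 - \<alpha>/n\<close>.  Since \<open>p/q = 1 - p \<alpha>/n\<close>, pointwise
  \<open>|f| = (|f| powr (p/(q \<theta>))) powr \<theta> * (|f| powr p) powr (1 - \<theta>)\<close>.  On each ball, Hoelder's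
  inequality with exponents \<open>1/\<theta>\<close> and \<open>1/(1 - \<theta>)\<close> splits the integral of \<open>|f|\<close>, and the
  normalising factor \<open>|B| powr \<theta>\<close> is absorbed by the first of the two integrals.\<close>

lemma ennreal_powr_ennreal: "0 \<le> a \<Longrightarrow> ennreal_powr (ennreal a) t = ennreal (a powr t)"
  by (simp add: ennreal_powr_def)

lemma ennreal_powr_top [simp]: "ennreal_powr top t = top"
  by (simp add: ennreal_powr_def)

lemma ennreal_powr_one [simp]: "ennreal_powr a 1 = a"
  by (cases a) (auto simp: ennreal_powr_ennreal)

lemma ennreal_powr_eq_0_iff [simp]: "ennreal_powr a t = 0 \<longleftrightarrow> a = 0"
  by (cases a) (auto simp: ennreal_powr_ennreal)

lemma ennreal_powr_mono:
  assumes "a \<le> b" "0 \<le> t"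
  shows "ennreal_powr a t \<le> ennreal_powr b t"
proof (cases b)
  case b: (real s)
  with assms obtain r where "0 \<le> r" "a = ennreal r" by (cases a) (auto simp: top_unique)
  with b assms show ?thesis
    by (auto simp: ennreal_powr_ennreal intro!: ennreal_leI powr_mono2)
qed simp

lemma ennreal_powr_divide:
  assumes "0 < b"
  shows "ennreal_powr (a / ennreal b) t = ennreal_powr a t / ennreal_powr (ennreal b) t"
proof (cases a)
  case (real r)
  with assms show ?thesis
    by (simp add: divide_ennreal ennreal_powr_ennreal powr_divide)
next
  case top
  with assms show ?thesis
    by (simp add: ennreal_top_divide ennreal_powr_ennreal)
qed

text \<open>Young's inequality for the normalised numbers \<open>a / A\<close> and
  \<open>b / B\<close>, multiplied back by the constants. The scales \<open>A\<close> and
  \<open>B\<close> are left free so that they can be the integrals of two functions: the right side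
  then integrates to exactly \<open>A powr t * B powr (1 - t)\<close>.\<close>

lemma powr_mult_powr_le_weighted_mean:
  fixes a b A B t :: real
  assumes "0 < t" "t < 1" "0 \<le> a" "0 \<le> b" "0 < A" "0 < B"
  shows "a powr t * b powr (1 - t) \<le> A powr t * B powr (1 - t) * (t * (a / A) + (1 - t) * (b / B))"
proof (cases "a = 0 \<or> b = 0")
  case True
  then show ?thesis using assms by auto
next
  case False
  then have "(a / A) powr t * (b / B) powr (1 - t) \<le> t * (a / A) + (1 - t) * (b / B)"
    using assms by (intro Youngs_inequality_0) auto
  then show ?thesis
    using assms by (simp add: powr_divide field_simps)
qed

text \<open>Hoelder's inequality for the exponents \<open>1 / t\<close> and
  \<open>1 / (1 - t)\<close>, written for powers so that the integrals on the right are those of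
  \<open>g\<close> and \<open>h\<close> themselves. In the main case it is the weighted mean bound,
  integrated with \<open>A\<close> and \<open>B\<close> equal to these integrals.\<close>

lemma nn_integral_Hoelder_powr:
  fixes g h :: "'a \<Rightarrow> real"
  assumes [measurable]: "g \<in> borel_measurable M" "h \<in> borel_measurable M"
    and nonneg: "\<And>x. 0 \<le> g x" "\<And>x. 0 \<le> h x"
    and t: "0 < t" "t < 1"
  shows "(\<integral>\<^sup>+x. ennreal (g x powr t * h x powr (1 - t)) \<partial>M)
    \<le> ennreal_powr (\<integral>\<^sup>+x. ennreal (g x) \<partial>M) t * ennreal_powr (\<integral>\<^sup>+x. ennreal (h x) \<partial>M) (1 - t)"
    (is "?I \<le> ennreal_powr ?G t * ennreal_powr ?H (1 - t)")
proof -
  \<comment> \<open>The zero cases are split off first because \<open>0 * top = 0\<close> in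
    \<open>ennreal\<close>: if one integral vanishes, the left integrand must vanish almost
    everywhere even when the other integral is infinite. In the third case the right side is then
    \<open>top\<close>.\<close>
  consider "?G = 0" | "?H = 0" | "?G = top \<or> ?H = top" "?G \<noteq> 0" "?H \<noteq> 0"
    | "?G \<noteq> 0" "?G \<noteq> top" "?H \<noteq> 0" "?H \<noteq> top" by blast
  then show ?thesis
  proof cases
    case 1
    then have "AE x in M. g x = 0"
      by (simp add: nn_integral_0_iff_AE nonneg antisym_conv)
    then have "AE x in M. ennreal (g x powr t * h x powr (1 - t)) = 0"
      by eventually_elim simp
    then have "?I = 0"
      by (subst nn_integral_0_iff_AE) auto
    then show ?thesis by simp
  next
    case 2
    then have "AE x in M. h x = 0"
      by (simp add: nn_integral_0_iff_AE nonneg antisym_conv)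
    then have "AE x in M. ennreal (g x powr t * h x powr (1 - t)) = 0"
      by eventually_elim simp
    then have "?I = 0"
      by (subst nn_integral_0_iff_AE) auto
    then show ?thesis by simp
  next
    case 3
    then show ?thesis by (auto simp: ennreal_mult_top ennreal_top_mult)
  next
    case 4
    then obtain A B where A: "?G = ennreal A" "0 < A" and B: "?H = ennreal B" "0 < B"
      by (cases ?G; cases ?H) (auto simp: less_le)
    define C where "C = A powr t * B powr (1 - t)"
    have "C \<ge> 0" by (simp add: C_def)
    have "?I \<le> (\<integral>\<^sup>+x. ennreal (C * t / A) * ennreal (g x)
        + ennreal (C * (1 - t) / B) * ennreal (h x) \<partial>M)"
    proof (rule nn_integral_mono)
      fix x
      have "g x powr t * h x powr (1 - t) \<le> C * t / A * g x + C * (1 - t) / B * h x"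
        using powr_mult_powr_le_weighted_mean[OF t nonneg(1)[of x] nonneg(2)[of x] A(2) B(2)]
        by (simp add: C_def algebra_simps)
      moreover have "0 \<le> C * t / A" "0 \<le> C * (1 - t) / B"
        using \<open>C \<ge> 0\<close> t A B by auto
      ultimately show "ennreal (g x powr t * h x powr (1 - t))
          \<le> ennreal (C * t / A) * ennreal (g x) + ennreal (C * (1 - t) / B) * ennreal (h x)"
        using nonneg by (simp add: ennreal_leI del: times_divide_eq_left flip: ennreal_mult ennreal_plus)
    qed
    also have "\<dots> = ennreal (C * t / A) * ennreal A + ennreal (C * (1 - t) / B) * ennreal B"
      by (simp add: nn_integral_add nn_integral_cmult A B)
    also have "\<dots> = ennreal (C * t + C * (1 - t))"
      using \<open>C \<ge> 0\<close> t A B by (simp flip: ennreal_mult ennreal_plus)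
    also have "\<dots> = ennreal_powr ?G t * ennreal_powr ?H (1 - t)"
      using A B by (simp add: C_def ennreal_powr_ennreal ennreal_mult algebra_simps)
    finally show ?thesis .
  qed
qed

theorem mainTheorem1:
  fixes \<Omega> :: "(real ^ 'n) set" and \<alpha> :: real
    and p q f :: "real ^ 'n \<Rightarrow> real" and x :: "real ^ 'n"
  assumes "open \<Omega>"
    and "0 < \<alpha>" and "\<alpha> < real CARD('n)"
    and "p \<in> borel_measurable (lebesgue_on \<Omega>)"
    and "\<And>y. y \<in> \<Omega> \<Longrightarrow> 1 \<le> p y"
    and "1 < (INF y\<in>\<Omega>. ereal (p y))"
    and "(SUP y\<in>\<Omega>. ereal (p y)) < ereal (real CARD('n) / \<alpha>)"
    and "\<And>y. y \<in> \<Omega> \<Longrightarrow> 1 / q y = 1 / p y - \<alpha> / real CARD('n)"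
    and "f \<in> borel_measurable (lebesgue_on \<Omega>)"
    and "x \<in> \<Omega>"
  shows "fractional_maximal \<alpha> \<Omega> f x
    \<le> ennreal_powr
         (hardy_littlewood_maximal \<Omega>
            (\<lambda>y. \<bar>f y\<bar> powr (p y / q y * (real CARD('n) / (real CARD('n) - \<alpha>)))) x)
         (1 - \<alpha> / real CARD('n))
      * ennreal_powr (\<integral>\<^sup>+ y \<in> \<Omega>. ennreal (\<bar>f y\<bar> powr p y) \<partial>lebesgue)
         (\<alpha> / real CARD('n))"
proof -
  define n where "n = real CARD('n)"
  define t where "t = 1 - \<alpha> / n"
  define g where "g = (\<lambda>y. \<bar>f y\<bar> powr (p y / q y * (n / (n - \<alpha>))))"
  define h where "h = (\<lambda>y. \<bar>f y\<bar> powr p y)"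
  have n: "0 < n" "\<alpha> < n" using assms(3) by (auto simp: n_def)
  have t: "0 < t" "t < 1" and t_compl: "1 - t = \<alpha> / n"
    using n assms(2) by (auto simp: t_def field_simps)
  \<comment> \<open>The relation between \<open>p\<close> and \<open>q\<close> reads
    \<open>1 / q = 1 / p - (1 - t)\<close>, and \<open>n / (n - \<alpha>)\<close> is
    \<open>1 / t\<close>, so \<open>q\<close> disappears from the exponent.\<close>
  have exponent: "p y / q y * (n / (n - \<alpha>)) = (1 - p y * (1 - t)) / t" if "y \<in> \<Omega>" for y
  proof -
    have "p y / q y = p y * (1 / p y - (1 - t))"
      using assms(8)[OF that] t_compl by (simp add: n_def divide_inverse)
    also have "\<dots> = 1 - p y * (1 - t)"
      using assms(5)[OF that] by (simp add: field_simps)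
    finally have "p y / q y = 1 - p y * (1 - t)" .
    moreover have "n / (n - \<alpha>) = 1 / t"
      using n by (simp add: t_def field_simps)
    ultimately show ?thesis by (metis times_divide_eq_right mult.right_neutral)
  qed
  \<comment> \<open>The exponents add up to 1. Zeros of \<open>f\<close> need no separate case,
    since \<open>0 powr s = 0\<close> for every real \<open>s\<close>.\<close>
  have split: "\<bar>f y\<bar> = g y powr t * h y powr (1 - t)" if "y \<in> \<Omega>" for y
  proof -
    have "g y = \<bar>f y\<bar> powr ((1 - p y * (1 - t)) / t)"
      unfolding g_def exponent[OF that] ..
    then have "g y powr t * h y powr (1 - t) = \<bar>f y\<bar> powr (1 - p y * (1 - t) + p y * (1 - t))"
      using t by (simp add: h_def powr_powr flip: powr_add)
    then show ?thesis by simp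
  qed
  \<comment> \<open>Measurability of \<open>g\<close> comes from that of \<open>f\<close> and
    \<open>p\<close>, once \<open>exponent\<close> has removed \<open>q\<close> on \<Omega>.\<close>
  have g_meas: "g \<in> borel_measurable (lebesgue_on \<Omega>)"
  proof -
    have "(\<lambda>y. \<bar>f y\<bar> powr ((1 - p y * (1 - t)) / t)) \<in> borel_measurable (lebesgue_on \<Omega>)"
      using assms(4,9) by measurable
    then show ?thesis
      by (rule measurable_cong[THEN iffD1, rotated]) (simp only: g_def exponent space_lebesgue_on)
  qed
  have h_meas: "h \<in> borel_measurable (lebesgue_on \<Omega>)"
    unfolding h_def using assms(4,9) by measurable
  let ?M = "fractional_maximal 0 \<Omega> g x"
  let ?H = "\<integral>\<^sup>+ y \<in> \<Omega>. ennreal (h y) \<partial>lebesgue"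
  have "(\<integral>\<^sup>+ y \<in> ball c r \<inter> \<Omega>. ennreal \<bar>f y\<bar> \<partial>lebesgue)
      / ennreal_powr (emeasure lebesgue (ball c r)) t
    \<le> ennreal_powr ?M t * ennreal_powr ?H (1 - t)" (is "?F / _ \<le> _")
    if r: "0 < r" "x \<in> ball c r" for c r
  proof -
    let ?D = "ball c r \<inter> \<Omega>"
    let ?G = "\<integral>\<^sup>+ y \<in> ?D. ennreal (g y) \<partial>lebesgue"
    let ?HD = "\<integral>\<^sup>+ y \<in> ?D. ennreal (h y) \<partial>lebesgue"
    define b where "b = measure lebesgue (ball c r)"
    have b: "emeasure lebesgue (ball c r) = ennreal b" "0 < b"
      using r by (auto simp: b_def emeasure_eq_ennreal_measure fmeasurableD2
          content_ball_pos)
    \<comment> \<open>Hoelder is applied to the measure restricted to \<open>?D\<close>, because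
      \<open>g\<close> and \<open>h\<close> are known to be measurable only on \<Omega>.\<close>
    have on_D: "(\<integral>\<^sup>+ y \<in> ?D. u y \<partial>lebesgue) = (\<integral>\<^sup>+ y. u y \<partial>lebesgue_on ?D)" for u
      using \<open>open \<Omega>\<close> by (subst nn_integral_restrict_space) auto
    have "?F = (\<integral>\<^sup>+ y \<in> ?D. ennreal (g y powr t * h y powr (1 - t)) \<partial>lebesgue)"
      by (rule nn_integral_cong) (auto simp: indicator_def simp flip: split)
    also have "\<dots> \<le> ennreal_powr ?G t * ennreal_powr ?HD (1 - t)"
      unfolding on_D
      using g_meas h_meas t
      by (intro nn_integral_Hoelder_powr) (auto intro: measurable_restrict_mono simp: g_def h_def)
    \<comment> \<open>Only the second integral is enlarged to \<Omega>; the first stays on the ball,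
      where it becomes an average.\<close>
    also have "\<dots> \<le> ennreal_powr ?G t * ennreal_powr ?H (1 - t)"
      using t by (intro mult_left_mono ennreal_powr_mono nn_integral_mono) (auto simp: indicator_def)
    finally have "?F / ennreal_powr (ennreal b) t
        \<le> ennreal_powr ?G t * ennreal_powr ?H (1 - t) / ennreal_powr (ennreal b) t"
      by (rule divide_right_mono_ennreal)
    also have "\<dots> = ennreal_powr (?G / ennreal b) t * ennreal_powr ?H (1 - t)"
      unfolding ennreal_powr_divide[OF b(2)] by (simp add: divide_ennreal_def mult_ac)
    also have "\<dots> \<le> ennreal_powr ?M t * ennreal_powr ?H (1 - t)"
    proof -
      have "?G / ennreal b \<le> ?M"
        unfolding fractional_maximal_def
        \<comment> \<open>For the parameter 0 the normalising exponent \<open>1 - 0 / n\<close> is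
          1, so this ball contributes precisely the average of \<open>g\<close>, which is
          nonnegative.\<close>
        by (rule SUP_upper2[of "ball c r"]) (use r b in \<open>auto simp: g_def\<close>)
      then show ?thesis
        using t by (intro mult_right_mono ennreal_powr_mono) auto
    qed
    finally show ?thesis by (simp add: b)
  qed
  then have "fractional_maximal \<alpha> \<Omega> f x \<le> ennreal_powr ?M t * ennreal_powr ?H (1 - t)"
    unfolding fractional_maximal_def[of \<alpha>] by (intro SUP_least) (auto simp: t_def n_def)
  then show ?thesis
    unfolding t_compl by (simp add: g_def h_def t_def n_def)
qed

end
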